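(* Let $L, M \subseteq \mathbb{R}^d$ be two full-rank lattices with $\mathrm{vol}(L) = \mathrm{vol}(M)$. Then there exists a bounded (not necessarily measurable) set $F \subseteq \mathbb{R}^d$ that is a common fundamental domain of $L$ and $M$ in $\mathbb{R}^d$.
   Context: A full-rank lattice in $\mathbb{R}^d$ is a discrete subgroup of $\mathbb{R}^d$ whose $\mathbb{R}$-linear span is $\mathbb{R}^d$; equivalently, a set of the form $A\mathbb{Z}^d$ with $A$ a non-singular real $d\times d$ matrix. Its volume is $\mathrm{vol}(A\mathbb{Z}^d) := |\det A|$, which does not depend on the choice of $A$. A fundamental domain of a lattice $L$ in $\mathbb{R}^d$ is a set $F\subseteq\mathbb{R}^d$ that contains exactly one element of each coset of $L$ in $\mathbb{R}^d$ (exactly one, for every coset, with no null-set exceptions). A common fundamental domain of $L$ and $M$ is a single set that is a fundamental domain of $L$ and also a fundamental domain of $M$. *)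

theory Defs
  imports "HOL-Analysis.Analysis"
begin

definition full_rank_lattice :: "(real ^ 'n) set \<Rightarrow> bool" where
  "full_rank_lattice L \<longleftrightarrow>
     0 \<in> L \<and> (\<forall>x\<in>L. \<forall>y\<in>L. x + y \<in> L) \<and> (\<forall>x\<in>L. - x \<in> L) \<and>
     discrete L \<and> span L = UNIV"

definition int_vectors :: "(real ^ 'n) set" where
  "int_vectors = {x. \<forall>i. x $ i \<in> \<int>}"

(* Not meaningful unless L is a full-rank lattice; lattice_vol_eq below shows that the
   value does not depend on the choice of A. *)
definition lattice_vol :: "(real ^ 'n) set \<Rightarrow> real" where
  "lattice_vol L =
     (THE v. \<exists>A :: real ^ 'n ^ 'n. invertible A \<and> L = (*v) A ` int_vectors \<and> v = \<bar>det A\<bar>)"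

definition fundamental_domain :: "(real ^ 'n) set \<Rightarrow> (real ^ 'n) set \<Rightarrow> bool" where
  "fundamental_domain L F \<longleftrightarrow> (\<forall>x. \<exists>!y. y \<in> F \<inter> (+) x ` L)"

lemma det_Ints:
  fixes U :: "real ^ 'n ^ 'n"
  assumes "\<And>i j. U $ i $ j \<in> \<int>"
  shows "det U \<in> \<int>"
  unfolding det_def by (intro Ints_sum Ints_mult Ints_prod assms) auto

lemma int_vectors_change_of_basis:
  fixes A B :: "real ^ 'n ^ 'n"
  assumes "invertible A" "(*v) B ` int_vectors \<subseteq> (*v) A ` int_vectors"
  shows "\<exists>U. (\<forall>i j. U $ i $ j \<in> \<int>) \<and> B = A ** U"
proof (intro exI conjI allI)
  let ?U = "matrix_inv A ** B"
  have inv: "A ** matrix_inv A = mat 1" "matrix_inv A ** A = mat 1"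
    using someI_ex[OF assms(1)[unfolded invertible_def]] by (simp_all add: matrix_inv_def)
  show "B = A ** ?U"
    by (simp add: matrix_mul_assoc inv)
  fix i j
  have "axis j 1 \<in> (int_vectors :: (real ^ 'n) set)"
    by (auto simp: int_vectors_def axis_def)
  then obtain w where w: "w \<in> int_vectors" "B *v axis j 1 = A *v w"
    using assms(2) by blast
  have "?U *v axis j 1 = matrix_inv A *v (A *v w)"
    by (metis w(2) matrix_vector_mul_assoc)
  also have "\<dots> = w"
    by (simp add: matrix_vector_mul_assoc inv)
  finally have "column j ?U = w"
    by (simp add: matrix_vector_mul_component matrix_vector_mult_basis)
  then show "?U $ i $ j \<in> \<int>"
    using w(1) by (auto simp: int_vectors_def column_def)
qed

lemma det_abs_unique:
  fixes A B :: "real ^ 'n ^ 'n"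
  assumes "invertible A" "invertible B" "(*v) A ` int_vectors = (*v) B ` int_vectors"
  shows "\<bar>det A\<bar> = \<bar>det B\<bar>"
proof -
  have le: "\<bar>det C\<bar> \<le> \<bar>det D\<bar>"
    if CD: "invertible C" "invertible D" "(*v) C ` int_vectors = (*v) D ` int_vectors"
    for C D :: "real ^ 'n ^ 'n"
  proof -
    obtain U where U: "\<And>i j. U $ i $ j \<in> \<int>" "D = C ** U"
      using int_vectors_change_of_basis[of C D] CD by blast
    have "det D = det C * det U"
      using U(2) by (simp add: det_mul)
    moreover have "det D \<noteq> 0"
      using CD by (simp add: invertible_det_nz)
    ultimately have "det U \<noteq> 0" by auto
    then have "1 \<le> \<bar>det U\<bar>"
      using det_Ints[of U] U(1) by (simp add: Ints_nonzero_abs_ge1)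
    then show ?thesis
      using \<open>det D = det C * det U\<close> by (simp add: abs_mult mult_le_cancel_left1)
  qed
  show ?thesis
    using le[of A B] le[of B A] assms by force
qed

lemma lattice_vol_eq:
  fixes A :: "real ^ 'n ^ 'n"
  assumes "invertible A"
  shows "lattice_vol ((*v) A ` int_vectors) = \<bar>det A\<bar>"
  unfolding lattice_vol_def
  by (rule the_equality) (use assms det_abs_unique in blast)+

end

theory Submission
  imports Defs
begin

text \<open>
  Call a coset of $L$ and a coset of $M$ adjacent through a point of $\mathbb{R}^d$ that lies in both.
  A set $F$ is a common fundamental domain iff its points, read as edges of this bipartite
  multigraph, form a perfect matching between all cosets of $L$ and all cosets of $M$.
  A bounded $F$ is found by keeping only the points of a suitable bounded set $E$; since lattices are
  discrete, every coset then has finite degree, and Hall's condition can be checked.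

  Hall's condition is a consequence of a fractional perfect matching. Let $D$ and $D'$ be bounded
  measurable fundamental domains (parallelepipeds) of $L$ and $M$, and give the point $e$ the weight
  $g(e) = \mathrm{vol}(D' \cap (D - e))$, which vanishes outside the bounded set $E = D - D'$.
  When $e$ runs through a coset of $L$, the sets $D - e$ tile space, so the weights sum to
  $\mathrm{vol}(D')$. By translation invariance also $g(e) = \mathrm{vol}(D \cap (D' + e))$, and when $e$ runs
  through a coset of $M$ the sets $D' + e$ tile space, so the weights sum to $\mathrm{vol}(D)$. The
  two values agree exactly because the lattices have the same volume. Thus every vertex has the same
  positive total weight, and counting the weight of the edges that leave a finite set of vertices
  gives Hall's condition on both sides.

  The rest is \<open>fractional_imp_perfect_matching\<close>: Hall's theorem for infinite graphs of finite
  degree, applied on each side, and a merging of the two matchings in the manner of Schroeder and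
  Bernstein. Two facts on lattices feed the argument: \<open>full_rank_lattice_basis\<close>, by which a discrete
  spanning subgroup has the form $A\mathbb{Z}^d$, and \<open>measure_linear_image_abs_det\<close>, by which the
  parallelepiped spanned by $A$ has volume $|\det A|$.
\<close>

section \<open>Matchings from fractional matchings\<close>

text \<open> Hall's condition for a bipartite multigraph given by its edges: the edge \<open>e\<close> joins the left
  vertex \<open>p e\<close> to the right vertex \<open>q e\<close>. With edges rather than pairs of vertices as the basic
  objects, a matching is a set of edges on which \<open>p\<close> and \<open>q\<close> are injective. \<close>
definition hall :: "('a \<Rightarrow> 'b) \<Rightarrow> ('a \<Rightarrow> 'c) \<Rightarrow> 'b set \<Rightarrow> 'a set \<Rightarrow> bool" where
  "hall p q X E \<longleftrightarrow> (\<forall>S. finite S \<longrightarrow> S \<subseteq> X \<longrightarrow> card S \<le> card (q ` {e \<in> E. p e \<in> S}))"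

lemma finite_edges_over:
  assumes "\<And>x. finite {e \<in> E. p e = x}" "finite S"
  shows "finite {e \<in> E. p e \<in> S}"
proof -
  have "{e \<in> E. p e \<in> S} = (\<Union>x\<in>S. {e \<in> E. p e = x})" by auto
  then show ?thesis using assms by simp
qed

text \<open> The limit step of Zorn's lemma, phrased with the sets \<open>D\<close> of deleted edges. Only finitely many edges
  start in a given finite set of vertices, so a single member of the chain already deletes all of
  those that the union deletes. \<close>
lemma hall_Inter_chain:
  assumes fin: "\<And>x. finite {e \<in> E. p e = x}"
    and ch: "subset.chain {D. D \<subseteq> E \<and> hall p q X (E - D)} \<C>" "\<C> \<noteq> {}"
  shows "hall p q X (E - \<Union>\<C>)"
  unfolding hall_def
proof (intro allI impI)
  fix S assume S: "finite S" "S \<subseteq> X"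
  let ?K = "{e \<in> E. p e \<in> S}"
  have "finite (?K \<inter> \<Union>\<C>)" "?K \<inter> \<Union>\<C> \<subseteq> \<Union>\<C>"
    using finite_edges_over[OF fin S(1)] by auto
  then obtain D where D: "D \<in> \<C>" "?K \<inter> \<Union>\<C> \<subseteq> D"
    using finite_subset_Union_chain[of "?K \<inter> \<Union>\<C>" \<C> _] ch by blast
  have "{e \<in> E - \<Union>\<C>. p e \<in> S} = {e \<in> E - D. p e \<in> S}"
    using D by blast
  moreover have "hall p q X (E - D)"
    using ch(1) D(1) by (auto simp: subset.chain_def)
  ultimately show "card S \<le> card (q ` {e \<in> E - \<Union>\<C>. p e \<in> S})"
    using S by (simp add: hall_def)
qed

lemma minimal_hall_set:
  assumes fin: "\<And>x. finite {e \<in> E. p e = x}" and h: "hall p q X E"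
  obtains G where "G \<subseteq> E" "hall p q X G" "\<And>e. e \<in> G \<Longrightarrow> \<not> hall p q X (G - {e})"
proof -
  let ?A = "{D. D \<subseteq> E \<and> hall p q X (E - D)}"
  have "\<exists>D\<in>?A. \<forall>D'\<in>?A. D \<subseteq> D' \<longrightarrow> D' = D"
  proof (rule subset_Zorn_nonempty)
    show "?A \<noteq> {}" using h by (auto intro: exI[of _ "{}"])
    show "\<Union>\<C> \<in> ?A" if "\<C> \<noteq> {}" "subset.chain ?A \<C>" for \<C>
      using hall_Inter_chain[OF fin that(2,1)] that(2) by (auto simp: subset.chain_def)
  qed
  then obtain D where "D \<in> ?A" and max: "\<forall>D'\<in>?A. D \<subseteq> D' \<longrightarrow> D' = D"
    by (rule bexE)
  then have D: "D \<subseteq> E" "hall p q X (E - D)" by simp_all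
  have "\<not> hall p q X (E - D - {e})" if "e \<in> E - D" for e
  proof
    assume "hall p q X (E - D - {e})"
    moreover have "E - insert e D = E - D - {e}" by blast
    ultimately have "insert e D = D"
      using D(1) that by (intro max[rule_format]) auto
    then show False using that by blast
  qed
  then show ?thesis using that[of "E - D"] D by simp
qed

text \<open> Rado's argument. Suppose two edges \<open>a\<close>, \<open>b\<close> left the same vertex. By minimality each of them is
  needed by some finite set (\<open>S\<close> for \<open>a\<close>, \<open>T\<close> for \<open>b\<close>) that has too few neighbours once the edge is
  gone; both sets contain the common vertex. The neighbours of \<open>S \<union> T\<close> survive because each deleted
  edge is still present for the other set, so submodularity of the cardinality makes either
  \<open>S \<union> T\<close> or \<open>S \<inter> T\<close> without the common vertex violate Hall's condition in \<open>G\<close>. \<close>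
lemma minimal_hall_inj:
  assumes fin: "\<And>x. finite {e \<in> G. p e = x}" and h: "hall p q X G"
    and min: "\<And>e. e \<in> G \<Longrightarrow> \<not> hall p q X (G - {e})"
  shows "inj_on p G"
proof (rule inj_onI, rule ccontr)
  fix a b assume ab: "a \<in> G" "b \<in> G" "p a = p b" "a \<noteq> b"
  define N where "N e S = q ` {d \<in> G - {e}. p d \<in> S}" for e S
  have crit: "\<exists>S. finite S \<and> S \<subseteq> X \<and> p e \<in> S \<and> card (N e S) < card S" if e: "e \<in> G" for e
  proof -
    obtain S where S: "finite S" "S \<subseteq> X" "card (N e S) < card S"
      using min[OF e] unfolding hall_def N_def by (auto simp: not_le)
    have "p e \<in> S"
    proof (rule ccontr)
      assume "p e \<notin> S"
      then have "{d \<in> G - {e}. p d \<in> S} = {d \<in> G. p d \<in> S}" by auto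
      then show False using h S unfolding hall_def N_def by (metis not_le)
    qed
    then show ?thesis using S by blast
  qed
  obtain S T where S: "finite S" "S \<subseteq> X" "p a \<in> S" "card (N a S) < card S"
    and T: "finite T" "T \<subseteq> X" "p b \<in> T" "card (N b T) < card T"
    using crit ab(1,2) by meson
  have finN: "finite (N a S)" "finite (N b T)"
    using finite_edges_over[OF fin S(1)] finite_edges_over[OF fin T(1)]
    by (auto simp: N_def intro: finite_subset[rotated])
  have "q ` {d \<in> G. p d \<in> S \<union> T} \<subseteq> N a S \<union> N b T"
    using ab S(3) T(3) by (auto simp: N_def image_iff)
  then have "card (S \<union> T) \<le> card (N a S \<union> N b T)"
    using h S T finN unfolding hall_def
    by (meson card_mono finite_UnI le_sup_iff order_trans)
  moreover have "q ` {d \<in> G. p d \<in> S \<inter> T - {p a}} \<subseteq> N a S \<inter> N b T"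
    using ab by (auto simp: N_def)
  then have "card (S \<inter> T - {p a}) \<le> card (N a S \<inter> N b T)"
    using h S T finN unfolding hall_def
    by (meson Diff_subset card_mono finite_Diff finite_Int inf.coboundedI1 order_trans)
  moreover have "card (S \<inter> T) = Suc (card (S \<inter> T - {p a}))"
    using card_Suc_Diff1[of "S \<inter> T" "p a"] S(1,3) T(3) ab(3) by (metis IntI finite_Int)
  moreover have "card (S \<union> T) + card (S \<inter> T) = card S + card T"
    using card_Un_Int[OF S(1) T(1)] by simp
  moreover have "card (N a S \<union> N b T) + card (N a S \<inter> N b T) = card (N a S) + card (N b T)"
    using card_Un_Int[OF finN] by simp
  ultimately show False using S(4) T(4) by linarith
qed

text \<open> Hall's theorem for graphs whose left vertices have finite degree. In a minimal edge set that
  satisfies Hall's condition each left vertex has exactly one edge, and the condition for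
  two-element sets says that different left vertices use different right vertices. \<close>
lemma hall_matching:
  assumes fin: "\<And>x. finite {e \<in> E. p e = x}" and h: "hall p q (p ` E) E"
  obtains G where "G \<subseteq> E" "bij_betw p G (p ` E)" "inj_on q G"
proof -
  obtain G where G: "G \<subseteq> E" "hall p q (p ` E) G" "\<And>e. e \<in> G \<Longrightarrow> \<not> hall p q (p ` E) (G - {e})"
    using minimal_hall_set[OF fin h] by metis
  have finG: "finite {e \<in> G. p e = x}" for x
    by (rule finite_subset[OF _ fin[of x]]) (use G(1) in auto)
  have inj: "inj_on p G"
    using minimal_hall_inj[OF finG G(2,3)] .
  have "x \<in> p ` G" if "x \<in> p ` E" for x
  proof -
    have "card {x} \<le> card (q ` {e \<in> G. p e \<in> {x}})"
      using G(2)[unfolded hall_def, rule_format, of "{x}"] that by simp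
    then show ?thesis by (auto simp: Suc_le_eq card_gt_0_iff)
  qed
  then have "p ` G = p ` E" using G(1) by auto
  moreover have "inj_on q G"
  proof (rule inj_onI, rule ccontr)
    fix a b assume ab: "a \<in> G" "b \<in> G" "q a = q b" "a \<noteq> b"
    then have "p a \<noteq> p b" using inj by (auto dest: inj_onD)
    then have "card {p a, p b} = 2" by simp
    have "{e \<in> G. p e \<in> {p a, p b}} = {a, b}"
      using ab inj by (auto dest: inj_onD)
    then have "q ` {e \<in> G. p e \<in> {p a, p b}} = {q a}" using ab by simp
    moreover have "{p a, p b} \<subseteq> p ` E" using G(1) ab(1,2) by blast
    then have "card {p a, p b} \<le> card (q ` {e \<in> G. p e \<in> {p a, p b}})"
      using G(2)[unfolded hall_def, rule_format, of "{p a, p b}"] by simp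
    ultimately show False using \<open>card {p a, p b} = 2\<close> by simp
  qed
  ultimately show ?thesis using that G(1) inj by (auto simp: bij_betw_def)
qed

text \<open> The usual Schroeder--Bernstein theorem only yields some bijection; here it has to run along edges of
  the two given matchings. A fixed point \<open>A\<close> of the monotone map in the proof marks the left vertices
  that keep their edge from \<open>G\<close>; all right vertices not reached by these keep their edge from \<open>H\<close>. \<close>
lemma matching_Schroeder_Bernstein:
  assumes G: "bij_betw p G X" "inj_on q G" "q ` G \<subseteq> Y"
    and H: "bij_betw q H Y" "inj_on p H" "p ` H \<subseteq> X"
  obtains F where "F \<subseteq> G \<union> H" "bij_betw p F X" "bij_betw q F Y"
proof -
  define G' where "G' A = {e \<in> G. p e \<in> A}" for A
  define H' where "H' A = {e \<in> H. q e \<notin> q ` G' A}" for A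
  have "mono (\<lambda>A. X - p ` H' A)"
    unfolding H'_def G'_def by (rule monoI) blast
  then obtain A where A: "A = X - p ` H' A"
    using lfp_unfold by blast
  have "p ` G' A = A" 
    using A G(1) by (auto simp: G'_def bij_betw_def)
  moreover have "p ` H' A = X - A"
    using A H(3) by (auto simp: H'_def)
  moreover have "inj_on p (G' A)" "inj_on p (H' A)" "inj_on q (G' A)" "inj_on q (H' A)"
    using G H by (auto simp: G'_def H'_def bij_betw_def intro: inj_on_subset)
  moreover have "q ` H' A = Y - q ` G' A"
    using H(1) by (auto simp: H'_def bij_betw_def)
  moreover have "q ` G' A \<subseteq> Y" using G(3) by (auto simp: G'_def)
  moreover have "A \<subseteq> X" using A by blast
  ultimately have "bij_betw p (G' A \<union> H' A) (A \<union> (X - A))"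
    "bij_betw q (G' A \<union> H' A) (q ` G' A \<union> (Y - q ` G' A))"
    by (intro bij_betw_combine; simp add: bij_betw_def)+
  then have "bij_betw p (G' A \<union> H' A) X" "bij_betw q (G' A \<union> H' A) Y"
    using \<open>A \<subseteq> X\<close> \<open>q ` G' A \<subseteq> Y\<close> by (simp_all add: Un_absorb1)
  then show ?thesis using that[of "G' A \<union> H' A"] by (auto simp: G'_def H'_def)
qed

text \<open> Double counting: the edges over \<open>S\<close> carry total weight \<open>card S * v\<close>, and they are among the edges
  ending in the neighbours of \<open>S\<close>, which carry \<open>v\<close> times the number of neighbours. \<close>
lemma weighted_hall:
  fixes g :: "'a \<Rightarrow> real"
  assumes g: "\<And>e. 0 \<le> g e" and v: "0 < v"
    and p: "\<And>e. e \<in> E \<Longrightarrow> finite {d \<in> E. p d = p e} \<and> sum g {d \<in> E. p d = p e} = v"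
    and q: "\<And>e. e \<in> E \<Longrightarrow> finite {d \<in> E. q d = q e} \<and> sum g {d \<in> E. q d = q e} = v"
  shows "hall p q (p ` E) E"
  unfolding hall_def
proof (intro allI impI)
  have sum_fibres: "finite {d \<in> E. r d \<in> S} \<and> sum g {d \<in> E. r d \<in> S} = card S * v"
    if r: "\<And>e. e \<in> E \<Longrightarrow> finite {d \<in> E. r d = r e} \<and> sum g {d \<in> E. r d = r e} = v"
      and S: "finite S" "S \<subseteq> r ` E" for r :: "'a \<Rightarrow> 'x" and S
  proof -
    have fin: "finite {d \<in> E. r d = x}" and s: "sum g {d \<in> E. r d = x} = v" if "x \<in> S" for x
      using r S(2) that by auto
    have eq: "{d \<in> E. r d \<in> S} = (\<Union>x\<in>S. {d \<in> E. r d = x})" by auto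
    have "sum g {d \<in> E. r d \<in> S} = (\<Sum>x\<in>S. sum g {d \<in> E. r d = x})"
      unfolding eq by (rule sum.UNION_disjoint) (use S fin in auto)
    then show ?thesis using s S(1) fin by (auto simp: eq)
  qed
  fix S assume S: "finite S" "S \<subseteq> p ` E"
  let ?K = "{d \<in> E. p d \<in> S}"
  have K: "finite ?K" "sum g ?K = card S * v" using sum_fibres[OF p S] by auto
  have N: "finite {d \<in> E. q d \<in> q ` ?K}" "sum g {d \<in> E. q d \<in> q ` ?K} = card (q ` ?K) * v"
    using sum_fibres[OF q, of "q ` ?K"] K(1) by auto
  have "sum g ?K \<le> sum g {d \<in> E. q d \<in> q ` ?K}"
    using g N(1) by (intro sum_mono2) auto
  then show "card S \<le> card (q ` ?K)" using K(2) N(2) v by simp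
qed

theorem fractional_imp_perfect_matching:
  fixes g :: "'a \<Rightarrow> real"
  assumes g: "\<And>e. 0 \<le> g e" and v: "0 < v"
    and p: "\<And>e. e \<in> E \<Longrightarrow> finite {d \<in> E. p d = p e} \<and> sum g {d \<in> E. p d = p e} = v"
    and q: "\<And>e. e \<in> E \<Longrightarrow> finite {d \<in> E. q d = q e} \<and> sum g {d \<in> E. q d = q e} = v"
  obtains F where "F \<subseteq> E" "bij_betw p F (p ` E)" "bij_betw q F (q ` E)"
proof -
  have fin: "finite {e \<in> E. r e = x}"
    if "\<And>e. e \<in> E \<Longrightarrow> finite {d \<in> E. r d = r e}" for r :: "'a \<Rightarrow> 'x" and x
  proof (cases "x \<in> r ` E")
    case False
    then have "{e \<in> E. r e = x} = {}" by auto
    then show ?thesis by (metis finite.emptyI)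
  qed (use that in auto)
  obtain G where G: "G \<subseteq> E" "bij_betw p G (p ` E)" "inj_on q G"
    using hall_matching[OF fin weighted_hall[OF g v p q]] p by blast
  obtain H where H: "H \<subseteq> E" "bij_betw q H (q ` E)" "inj_on p H"
    using hall_matching[OF fin weighted_hall[OF g v q p]] q by blast
  obtain F where "F \<subseteq> G \<union> H" "bij_betw p F (p ` E)" "bij_betw q F (q ` E)"
    using matching_Schroeder_Bernstein[OF G(2,3) _ H(2,3)] G(1) H(1) by blast
  then show ?thesis using that G(1) H(1) by blast
qed

section \<open>Volumes of linear images\<close>

text \<open> Both the volume distortion and \<open>\<bar>det\<bar>\<close> are multiplicative, so it is enough to treat maps
  generating all linear maps: singular ones, coordinate scalings, coordinate swaps and shears.
  The last two have determinant \<open>\<plusminus>1\<close> and preserve the volume of boxes, hence all volumes. \<close>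
lemma measure_linear_image_abs_det:
  fixes f :: "real ^ 'n \<Rightarrow> real ^ 'n"
  assumes "linear f" "S \<in> lmeasurable"
  shows "f ` S \<in> lmeasurable \<and> measure lebesgue (f ` S) = \<bar>det (matrix f)\<bar> * measure lebesgue S"
proof -
  let ?P = "\<lambda>f :: real ^ 'n \<Rightarrow> real ^ 'n. \<forall>S \<in> lmeasurable.
     f ` S \<in> lmeasurable \<and> measure lebesgue (f ` S) = \<bar>det (matrix f)\<bar> * measure lebesgue S"
  have boxes: "?P f" if "linear f" "\<bar>det (matrix f)\<bar> = 1"
    "\<And>a b. measure lebesgue (f ` cbox a b) = measure lebesgue (cbox a b)" for f
  proof
    fix S :: "(real ^ 'n) set" assume "S \<in> lmeasurable"
    then show "f ` S \<in> lmeasurable \<and> measure lebesgue (f ` S) = \<bar>det (matrix f)\<bar> * measure lebesgue S"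
      using measure_linear_sufficient[OF that(1), of S 1] that(2,3) by simp
  qed
  have "?P f"
  proof (rule induct_linear_elementary[OF assms(1)])
    show "?P (f \<circ> g)" if "linear f" "linear g" and f: "?P f" and g: "?P g" for f g
    proof
      fix S :: "(real ^ 'n) set" assume "S \<in> lmeasurable"
      then have gS: "g ` S \<in> lmeasurable" "measure lebesgue (g ` S) = \<bar>det (matrix g)\<bar> * measure lebesgue S"
        using g by blast+
      then have fgS: "f ` g ` S \<in> lmeasurable"
        "measure lebesgue (f ` g ` S) = \<bar>det (matrix f)\<bar> * measure lebesgue (g ` S)"
        using f by blast+
      have "det (matrix (f \<circ> g)) = det (matrix f) * det (matrix g)"
        unfolding matrix_compose[OF that(2,1)] by (rule det_mul)
      then show "(f \<circ> g) ` S \<in> lmeasurable \<and>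
          measure lebesgue ((f \<circ> g) ` S) = \<bar>det (matrix (f \<circ> g))\<bar> * measure lebesgue S"
        using fgS gS(2) by (metis abs_mult image_comp mult.assoc)
    qed
    show "?P f" if f: "linear f" "\<And>x. f x $ i = 0" for f i
    proof -
      have "axis i 1 \<notin> range f"
        using f(2) by (metis axis_nth imageE zero_neq_one)
      then have "\<not> inj f" 
        using linear_injective_imp_surjective[OF f(1)] by auto
      then show ?thesis
        using negligible_linear_singular_image[OF f(1)] det_nz_iff_inj[OF f(1)]
        by (simp add: negligible_iff_measure)
    qed
    show "?P (\<lambda>x. \<chi> i. c i * x $ i)" for c
      by (simp add: measurable_stretch measure_stretch axis_def matrix_def det_diagonal)
  next
    fix m n :: 'n assume mn: "m \<noteq> n"
    let ?h = "\<lambda>x :: real ^ 'n. \<chi> i. x $ Transposition.transpose m n i"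
    show "?P ?h"
    proof (rule boxes)
      show lin: "linear ?h" by (rule linearI) (simp_all add: vec_eq_iff)
      have "?h \<circ> ?h = id" by (simp add: fun_eq_iff vec_eq_iff)
      then have "matrix ?h ** matrix ?h = mat 1"
        using matrix_compose[OF lin lin] by (simp add: matrix_id_mat_1)
      then have sq: "det (matrix ?h) * det (matrix ?h) = 1"
        unfolding det_mul[symmetric] by (simp only: det_I)
      have unit: "\<bar>d\<bar> = 1" if "d * d = 1" for d :: real
        using that by (auto simp: square_eq_1_iff)
      show "\<bar>det (matrix ?h)\<bar> = 1" by (rule unit) (rule sq)
      fix a b :: "real ^ 'n"
      show "measure lebesgue (?h ` cbox a b) = measure lebesgue (cbox a b)"
      proof (cases "cbox a b = {}")
        case False
        have eq: "?h ` cbox a b = cbox (?h a) (?h b)"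
        proof (intro set_eqI iffI)
          fix x assume x: "x \<in> cbox (?h a) (?h b)"
          have "?h (?h x) = x" by (simp add: vec_eq_iff)
          moreover have "?h x \<in> cbox a b"
            unfolding mem_box_cart
          proof
            fix i show "a $ i \<le> ?h x $ i \<and> ?h x $ i \<le> b $ i"
              using x[unfolded mem_box_cart, rule_format, of "Transposition.transpose m n i"] by simp
          qed
          ultimately show "x \<in> ?h ` cbox a b" by (rule image_eqI[OF sym])
        qed (auto simp: mem_box_cart)
        with False have "cbox (?h a) (?h b) \<noteq> {}" by blast
        then have "measure lebesgue (cbox (?h a) (?h b)) = (\<Prod>i\<in>UNIV. (b - a) $ Transposition.transpose m n i)"
          by (simp add: content_cbox_cart)
        also have "\<dots> = (\<Prod>i\<in>UNIV. (b - a) $ i)"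
          using prod.reindex_bij_betw[of "Transposition.transpose m n" UNIV UNIV "\<lambda>i. (b - a) $ i"] by simp
        also have "\<dots> = measure lebesgue (cbox a b)"
          using False by (simp add: content_cbox_cart)
        finally show ?thesis unfolding eq .
      qed simp
    qed
  next
    fix m n :: 'n assume mn: "m \<noteq> n"
    let ?h = "\<lambda>x :: real ^ 'n. \<chi> i. if i = m then x $ m + x $ n else x $ i"
    show "?P ?h"
    proof (rule boxes)
      show lin: "linear ?h" by (rule linearI) (auto simp: vec_eq_iff algebra_simps)
      have "matrix ?h = (\<chi> k. if k = m then row m (mat 1) + 1 *s row n (mat 1) else row k (mat 1))"
        by (auto simp: vec_eq_iff matrix_def row_def mat_def axis_def)
      then show "\<bar>det (matrix ?h)\<bar> = 1"
        using det_row_operation[OF mn, of "mat 1 :: real ^ 'n ^ 'n" 1] by simp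
      fix a b :: "real ^ 'n"
      show "measure lebesgue (?h ` cbox a b) = measure lebesgue (cbox a b)"
      proof (cases "cbox a b = {}")
        case False
        \<comment> \<open>The volume formula for sheared boxes needs a nonnegative corner, so move the corner to the origin.\<close>
        have box: "cbox a b = (+) a ` cbox 0 (b - a)"
          using cbox_translation[of a 0 "b - a"] by simp
        then have "?h ` cbox a b = (+) (?h a) ` ?h ` cbox 0 (b - a)"
          by (simp add: image_image linear_add[OF lin])
        then have "measure lebesgue (?h ` cbox a b) = measure lebesgue (?h ` cbox 0 (b - a))"
          by (simp only: measure_translation)
        also have "\<dots> = measure lebesgue (cbox 0 (b - a))"
          by (rule measure_shear_interval) (use mn False box in auto)
        also have "\<dots> = measure lebesgue (cbox a b)"
          by (simp only: box measure_translation)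
        finally show ?thesis .
      qed simp
    qed
  qed
  then show ?thesis using assms(2) by blast
qed

section \<open>Lattice bases and parallelepipeds\<close>

text \<open> An isolated point of a subgroup gives a uniform distance between its points, so a lattice is
  closed and meets compact sets in finite sets. \<close>
lemma lattice_finite_Int_bounded:
  fixes L :: "(real ^ 'n) set"
  assumes "full_rank_lattice L" "bounded B"
  shows "finite (L \<inter> B)"
proof -
  have L: "0 \<in> L" "\<And>x y. x \<in> L \<Longrightarrow> y \<in> L \<Longrightarrow> x - y \<in> L" "discrete L"
    using assms(1) unfolding full_rank_lattice_def by (auto simp: diff_conv_add_uminus simp del: add_uminus_conv_diff)
  obtain e where e: "e > 0" "\<And>y. y \<in> L \<Longrightarrow> dist 0 y < e \<Longrightarrow> y = 0"
    using discreteD[OF L(3,1)] unfolding isolated_in_dist_Ex_iff by blast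
  have "uniform_discrete L"
  proof (rule uniformI1[OF e(1)])
    fix x y assume "x \<in> L" "y \<in> L" "dist x y < e"
    then show "x = y" using e(2)[of "x - y"] L(2) by (auto simp: dist_norm norm_minus_commute)
  qed
  then have "uniform_discrete (L \<inter> B)" by (rule uniform_discrete_subset) auto
  then show ?thesis
    using uniform_discrete_finite_iff[of "L \<inter> B"] assms(2) by (simp add: bounded_Int)
qed

lemma lattice_of_int_scaleR:
  assumes "full_rank_lattice L" "x \<in> L"
  shows "of_int k *\<^sub>R x \<in> L"
proof -
  have nat: "of_nat m *\<^sub>R x \<in> L" for m
    using assms by (induction m) (auto simp: full_rank_lattice_def scaleR_add_left)
  have neg: "- y \<in> L" if "y \<in> L" for y
    using assms(1) that by (auto simp: full_rank_lattice_def)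
  show ?thesis
    using nat[of "nat k"] neg[OF nat[of "nat (-k)"]]
    by (cases "k \<ge> 0") (auto simp: scaleR_minus_left)
qed

lemma lattice_sum:
  assumes "full_rank_lattice L" "\<And>i. i \<in> I \<Longrightarrow> f i \<in> L"
  shows "sum f I \<in> L"
  using assms(2)
  by (induction I rule: infinite_finite_induct) (use assms(1) in \<open>auto simp: full_rank_lattice_def\<close>)

lemma lattice_int_combination:
  assumes L: "full_rank_lattice L" and A: "\<And>j. column j A \<in> L" and c: "c \<in> int_vectors"
  shows "A *v c \<in> L"
proof -
  have "c $ j *s column j A \<in> L" for j
  proof -
    obtain k :: int where "c $ j = of_int k"
      using c by (auto simp: int_vectors_def elim: Ints_cases)
    then show ?thesis
      using lattice_of_int_scaleR[OF L A] by (simp add: scalar_mult_eq_scaleR)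
  qed
  then show ?thesis
    unfolding matrix_mult_sum by (intro lattice_sum[OF L])
qed

definition floor_vec :: "real ^ 'n \<Rightarrow> real ^ 'n" where
  "floor_vec x = (\<chi> i. of_int \<lfloor>x $ i\<rfloor>)"

definition unit_cube :: "(real ^ 'n) set" where
  "unit_cube = {x. \<forall>i. 0 \<le> x $ i \<and> x $ i < 1}"

lemma floor_vec_int: "floor_vec x \<in> int_vectors"
  by (simp add: floor_vec_def int_vectors_def)

lemma frac_vec_unit_cube: "x - floor_vec x \<in> unit_cube"
  by (simp add: floor_vec_def unit_cube_def) linarith

lemma bounded_unit_cube: "bounded (unit_cube :: (real ^ 'n) set)"
proof (rule bounded_subset[OF bounded_cbox])
  show "unit_cube \<subseteq> cbox 0 (1 :: real ^ 'n)"
    by (auto simp: unit_cube_def mem_box_cart less_imp_le)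
qed

lemma bounded_matrix_unit_cube: "bounded ((*v) A ` unit_cube)"
  by (intro bounded_linear_image bounded_unit_cube matrix_vector_mul_bounded_linear)

lemma unit_cube_measure:
  "(unit_cube :: (real ^ 'n) set) \<in> lmeasurable" "measure lebesgue (unit_cube :: (real ^ 'n) set) = 1"
proof -
  have cb: "unit_cube \<subseteq> cbox 0 (1 :: real ^ 'n)" "box 0 (1 :: real ^ 'n) \<subseteq> unit_cube"
    by (auto simp: unit_cube_def mem_box_cart less_imp_le)
  show meas: "(unit_cube :: (real ^ 'n) set) \<in> lmeasurable"
  proof (rule measurable_convex[OF _ bounded_unit_cube])
    have eq: "unit_cube = (\<Inter>i. {x :: real ^ 'n. 0 \<le> x $ i} \<inter> {x. x $ i < 1})"
      by (auto simp: unit_cube_def)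
    have "convex {x :: real ^ 'n. 0 \<le> x $ i}" "convex {x :: real ^ 'n. x $ i < 1}" for i
      using convex_halfspace_ge[of 0 "axis i 1 :: real ^ 'n"] convex_halfspace_lt[of "axis i 1 :: real ^ 'n" 1]
      by (simp_all add: inner_axis')
    then show "convex (unit_cube :: (real ^ 'n) set)"
      unfolding eq by (intro convex_INT convex_Int)
  qed
  have one: "measure lebesgue (cbox 0 (1 :: real ^ 'n)) = 1"
    by (simp add: content_cbox_if_cart interval_ne_empty_cart)
  have "measure lebesgue (unit_cube :: (real ^ 'n) set) \<le> measure lebesgue (cbox 0 (1 :: real ^ 'n))"
    using cb(1) meas by (intro measure_mono_fmeasurable) auto
  moreover have "measure lebesgue (box 0 (1 :: real ^ 'n)) \<le> measure lebesgue (unit_cube :: (real ^ 'n) set)"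
    using cb(2) meas by (intro measure_mono_fmeasurable) auto
  moreover have "measure lebesgue (box 0 (1 :: real ^ 'n)) = measure lebesgue (cbox 0 (1 :: real ^ 'n))"
    by (simp add: measure_completion measure_lborel_box_eq measure_lborel_cbox_eq)
  ultimately show "measure lebesgue (unit_cube :: (real ^ 'n) set) = 1" using one by linarith
qed

lemma matrix_inv_cancel:
  fixes A :: "real ^ 'n ^ 'n"
  assumes "invertible A"
  shows "A *v (matrix_inv A *v x) = x" "matrix_inv A *v (A *v x) = x"
proof -
  have "A ** matrix_inv A = mat 1" "matrix_inv A ** A = mat 1"
    using someI_ex[OF assms[unfolded invertible_def]] by (simp_all add: matrix_inv_def)
  then show "A *v (matrix_inv A *v x) = x" "matrix_inv A *v (A *v x) = x"
    by (simp_all add: matrix_vector_mul_assoc)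
qed

lemma lattice_contains_basis:
  fixes L :: "(real ^ 'n) set"
  assumes "full_rank_lattice L"
  obtains A :: "real ^ 'n ^ 'n" where "invertible A" "\<And>j. column j A \<in> L"
proof -
  obtain B where B: "B \<subseteq> L" "independent B" "L \<subseteq> span B" "card B = dim L"
    using basis_exists by blast
  have span: "span B = UNIV"
    using assms B(3) span_minimal[of L "span B"] by (auto simp: full_rank_lattice_def)
  have "card B = CARD('n)"
    using dim_eq_card_independent[OF B(2)] dim_span[of B] span by (simp add: DIM_cart dim_UNIV)
  then obtain f :: "'n \<Rightarrow> real ^ 'n" where f: "bij_betw f UNIV B"
    using finite_same_card_bij[of "UNIV :: 'n set" B] independent_imp_finite[OF B(2)] by auto
  define A :: "real ^ 'n ^ 'n" where "A = (\<chi> i j. f j $ i)"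
  have col: "column j A = f j" for j by (simp add: A_def column_def vec_eq_iff)
  then have "columns A = B" using f by (auto simp: columns_def bij_betw_def)
  then have "\<exists>A'. A ** A' = mat 1"
    using span by (simp add: matrix_right_invertible_span_columns span_vec_eq)
  then have "invertible A" by (simp add: invertible_right_inverse)
  moreover have "f j \<in> L" for j using f B(1) by (auto simp: bij_betw_def)
  ultimately show ?thesis using that col by metis
qed

text \<open> Pigeonhole: the multiples \<open>j x\<close>, reduced modulo the sublattice spanned by the columns of \<open>A\<close>, lie
  in the finite set \<open>T\<close> of lattice points in the parallelepiped of \<open>A\<close>. So some multiple \<open>k x\<close> with
  \<open>1 \<le> k \<le> card T\<close> is an integer combination of the columns, and the factorial of \<open>card T\<close> serves
  every \<open>x\<close> at once. \<close>
lemma lattice_common_denominator: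
  fixes L :: "(real ^ 'n) set" and A :: "real ^ 'n ^ 'n"
  assumes L: "full_rank_lattice L" and A: "invertible A" "\<And>j. column j A \<in> L"
  obtains q :: nat where "q > 0" "\<And>x. x \<in> L \<Longrightarrow> real q *\<^sub>R (matrix_inv A *v x) \<in> int_vectors"
proof -
  define T where "T = L \<inter> (*v) A ` unit_cube"
  have fin: "finite T"
    unfolding T_def by (rule lattice_finite_Int_bounded[OF L bounded_matrix_unit_cube])
  have "real (fact (card T)) *\<^sub>R (matrix_inv A *v x) \<in> int_vectors" if x: "x \<in> L" for x
  proof -
    define c where "c = matrix_inv A *v x"
    define r where "r j = A *v (real j *\<^sub>R c - floor_vec (real j *\<^sub>R c))" for j :: nat
    have "r j \<in> T" for j
    proof -
      have "r j = of_int (int j) *\<^sub>R x + A *v (- floor_vec (real j *\<^sub>R c))"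
        unfolding r_def diff_conv_add_uminus matrix_vector_right_distrib
        by (simp add: c_def matrix_vector_mult_scaleR matrix_inv_cancel[OF A(1)])
      moreover have "- floor_vec (real j *\<^sub>R c) \<in> int_vectors"
        using floor_vec_int[of "real j *\<^sub>R c"] by (simp add: int_vectors_def)
      ultimately have "r j \<in> L"
        using lattice_of_int_scaleR[OF L x] lattice_int_combination[OF L A(2)] L
        unfolding full_rank_lattice_def by metis
      then show ?thesis using frac_vec_unit_cube by (auto simp: T_def r_def)
    qed
    then have "r ` {0..card T} \<subseteq> T" by blast
    then have "card (r ` {0..card T}) < card {0..card T}"
      using card_mono[OF fin] by (simp add: le_imp_less_Suc)
    then have "\<not> inj_on r {0..card T}" using card_image by fastforce
    then obtain i' j' where "i' \<noteq> j'" "i' \<le> card T" "j' \<le> card T" "r i' = r j'"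
      by (auto simp: inj_on_def)
    then obtain i j where ij: "i < j" "j \<le> card T" "r i = r j"
      by (metis linorder_neq_iff)
    have "real j *\<^sub>R c - floor_vec (real j *\<^sub>R c) = real i *\<^sub>R c - floor_vec (real i *\<^sub>R c)"
      using ij(3) unfolding r_def by (metis matrix_inv_cancel(2)[OF A(1)])
    then have "real (j - i) *\<^sub>R c = floor_vec (real j *\<^sub>R c) - floor_vec (real i *\<^sub>R c)"
      using ij(1) by (simp add: of_nat_diff algebra_simps)
    then have ints: "real (j - i) *\<^sub>R c \<in> int_vectors"
      by (simp add: int_vectors_def floor_vec_def)
    have "j - i dvd fact (card T)" using ij by (intro dvd_fact) auto
    then obtain m where "fact (card T) = (j - i) * m" by (elim dvdE)
    then have "real (fact (card T)) *\<^sub>R c = real m *\<^sub>R (real (j - i) *\<^sub>R c)"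
      by (metis mult.commute of_nat_mult scaleR_scaleR)
    moreover have "real m *\<^sub>R v \<in> int_vectors" if "v \<in> int_vectors" for v :: "real ^ 'n"
      using that by (simp add: int_vectors_def)
    ultimately show ?thesis
      using ints unfolding c_def by metis
  qed
  then show ?thesis using that[of "fact (card T)"] by simp
qed

text \<open> Relative to a fixed basis of space inside \<open>L\<close>, the coordinates of all lattice vectors have a common
  denominator, hence so have the determinants. This makes a smallest nonzero determinant exist. \<close>
lemma lattice_dets_discrete:
  fixes L :: "(real ^ 'n) set"
  assumes L: "full_rank_lattice L"
  obtains b where "b > 0" "\<And>A :: real ^ 'n ^ 'n. (\<And>j. column j A \<in> L) \<Longrightarrow> b * \<bar>det A\<bar> \<in> \<int>"
proof -
  obtain B :: "real ^ 'n ^ 'n" where B: "invertible B" "\<And>j. column j B \<in> L"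
    using lattice_contains_basis[OF L] by blast
  obtain q where q: "q > 0" "\<And>x. x \<in> L \<Longrightarrow> real q *\<^sub>R (matrix_inv B *v x) \<in> int_vectors"
    using lattice_common_denominator[OF L B] by blast
  define b where "b = real q ^ CARD('n) / \<bar>det B\<bar>"
  have dB: "det B \<noteq> 0" using B(1) by (simp add: invertible_det_nz)
  have "b * \<bar>det A\<bar> \<in> \<int>" if A: "\<And>j. column j A \<in> L" for A :: "real ^ 'n ^ 'n"
  proof -
    define U where "U = matrix_inv B ** A"
    have "A = B ** U"
      by (simp add: U_def matrix_eq flip: matrix_vector_mul_assoc) (simp add: matrix_inv_cancel[OF B(1)])
    then have detA: "det A = det B * det U" by (simp add: det_mul)
    have "real q * U $ i $ j \<in> \<int>" for i j
    proof -
      have "U $ i $ j = (matrix_inv B *v column j A) $ i"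
        by (simp add: U_def matrix_matrix_mult_def matrix_vector_mult_def column_def)
      then show ?thesis using q(2)[OF A[of j]] by (simp add: int_vectors_def)
    qed
    then have "det (\<chi> i. real q *s (U $ i)) \<in> \<int>"
      by (intro det_Ints) simp
    then have "\<bar>real q ^ CARD('n) * det U\<bar> \<in> \<int>"
      by (simp add: det_rows_mul Ints_abs)
    moreover have "b * \<bar>det A\<bar> = \<bar>real q ^ CARD('n) * det U\<bar>"
      using dB by (simp add: b_def detA abs_mult)
    ultimately show ?thesis by simp
  qed
  then show ?thesis using that[of b] q(1) dB by (simp add: b_def)
qed

text \<open> Choose linearly independent lattice vectors, the columns of \<open>A\<close>, with smallest \<open>\<bar>det A\<bar>\<close>. If a
  lattice vector had a coordinate that is not an integer, subtract integer parts to get a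
  lattice vector \<open>A *v d\<close> with \<open>0 < d $ k < 1\<close> for some \<open>k\<close>. By Cramer's rule, exchanging it
  for the column \<open>k\<close> would multiply the determinant by \<open>d $ k\<close>. \<close>
theorem full_rank_lattice_basis:
  fixes L :: "(real ^ 'n) set"
  assumes L: "full_rank_lattice L"
  obtains A :: "real ^ 'n ^ 'n" where "invertible A" "L = (*v) A ` int_vectors"
proof -
  obtain b where b: "b > 0" "\<And>A :: real ^ 'n ^ 'n. (\<And>j. column j A \<in> L) \<Longrightarrow> b * \<bar>det A\<bar> \<in> \<int>"
    using lattice_dets_discrete[OF L] by blast
  define P where "P A \<longleftrightarrow> invertible A \<and> (\<forall>j. column j A \<in> L)" for A :: "real ^ 'n ^ 'n"
  define size where "size A = nat \<lfloor>b * \<bar>det A\<bar>\<rfloor>" for A :: "real ^ 'n ^ 'n"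
  have size: "real (size A) = b * \<bar>det A\<bar>" if "P A" for A
    using b that by (auto simp: size_def P_def of_nat_nat elim: Ints_cases)
  obtain A0 where "P A0" using lattice_contains_basis[OF L] unfolding P_def by metis
  then obtain A where A: "P A" "\<And>A'. P A' \<Longrightarrow> size A \<le> size A'"
    using ex_has_least_nat[of P A0 size] by blast
  have inv: "invertible A" and col: "\<And>j. column j A \<in> L" using A(1) by (auto simp: P_def)
  have "L \<subseteq> (*v) A ` int_vectors"
  proof
    fix x assume x: "x \<in> L"
    define c where "c = matrix_inv A *v x"
    define d where "d = c - floor_vec c"
    have xc: "x = A *v c" by (simp add: c_def matrix_inv_cancel[OF inv])
    have "- floor_vec c \<in> int_vectors" 
      using floor_vec_int[of c] by (simp add: int_vectors_def)
    moreover have "A *v d = x + A *v (- floor_vec c)"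
      by (simp add: d_def xc flip: matrix_vector_right_distrib)
    ultimately have Ad: "A *v d \<in> L"
      using x lattice_int_combination[OF L col] L unfolding full_rank_lattice_def by metis
    have d01: "0 \<le> d $ k" "d $ k < 1" for k
      using frac_vec_unit_cube[of c] by (auto simp: d_def unit_cube_def)
    have "d $ k = 0" for k
    proof (rule ccontr)
      assume dk: "d $ k \<noteq> 0"
      define A' :: "real ^ 'n ^ 'n" where "A' = (\<chi> i j. if j = k then (A *v d) $ i else A $ i $ j)"
      have det': "det A' = d $ k * det A" unfolding A'_def by (rule cramer_lemma)
      have "column j A' = (if j = k then A *v d else column j A)" for j
        by (simp add: A'_def column_def vec_eq_iff)
      then have "P A'"
        using Ad col inv dk det' by (simp add: P_def invertible_det_nz)
      then have "real (size A) \<le> real (size A')" using A(2) by simp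
      then have "b * \<bar>det A\<bar> \<le> d $ k * (b * \<bar>det A\<bar>)"
        using size A(1) \<open>P A'\<close> det' d01(1)[of k] by (simp add: abs_mult mult.left_commute)
      moreover have "0 < b * \<bar>det A\<bar>" using b(1) inv by (simp add: invertible_det_nz)
      ultimately show False using d01(2)[of k] by (simp add: mult_le_cancel_right1)
    qed
    then have "c = floor_vec c" by (simp add: d_def vec_eq_iff)
    then show "x \<in> (*v) A ` int_vectors" using xc floor_vec_int[of c] by (metis imageI)
  qed
  moreover have "(*v) A ` int_vectors \<subseteq> L"
    using lattice_int_combination[OF L col] by blast
  ultimately show ?thesis using that inv by blast
qed

section \<open>Cosets and fundamental domains\<close>

lemma lattice_measurable_domain:
  fixes L :: "(real ^ 'n) set"
  assumes L: "full_rank_lattice L"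
  obtains D where "fundamental_domain L D" "bounded D" "D \<in> lmeasurable"
    "measure lebesgue D = lattice_vol L" "0 < lattice_vol L"
proof -
  obtain A :: "real ^ 'n ^ 'n" where A: "invertible A" "L = (*v) A ` int_vectors"
    using full_rank_lattice_basis[OF L] by blast
  define D where "D = (*v) A ` unit_cube"
  have "fundamental_domain L D"
    unfolding fundamental_domain_def
  proof (intro allI ex_ex1I)
    fix x
    let ?c = "matrix_inv A *v x"
    have "A *v (?c - floor_vec ?c) = x + A *v (- floor_vec ?c)"
      unfolding diff_conv_add_uminus matrix_vector_right_distrib
      by (simp add: matrix_inv_cancel[OF A(1)])
    moreover have "- floor_vec ?c \<in> int_vectors"
      using floor_vec_int[of ?c] by (simp add: int_vectors_def)
    ultimately show "\<exists>y. y \<in> D \<inter> (+) x ` L"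
      using frac_vec_unit_cube[of ?c] unfolding D_def A(2) by (metis IntI imageI)
    fix y z assume "y \<in> D \<inter> (+) x ` L" "z \<in> D \<inter> (+) x ` L"
    then obtain c d m n where y: "y = A *v c" "y = x + A *v m" "c \<in> unit_cube" "m \<in> int_vectors"
      and z: "z = A *v d" "z = x + A *v n" "d \<in> unit_cube" "n \<in> int_vectors"
      unfolding D_def A(2) by blast
    have "A *v (c - d) = A *v (m - n)"
      using y(1,2) z(1,2) unfolding matrix_vector_mult_diff_distrib by (metis add_diff_cancel_left)
    then have eq: "c - d = m - n" by (metis matrix_inv_cancel(2)[OF A(1)])
    have "c $ i = d $ i" for i
    proof -
      have "c $ i - d $ i \<in> \<int>"
        using arg_cong[OF eq, of "\<lambda>v. v $ i"] y(4) z(4) by (simp add: int_vectors_def)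
      moreover have "\<bar>c $ i - d $ i\<bar> < 1"
        using y(3) z(3) by (auto simp: unit_cube_def abs_less_iff) (smt (verit))+
      ultimately show ?thesis using Ints_nonzero_abs_less1 by force
    qed
    then have "c = d" by (simp add: vec_eq_iff)
    then show "y = z" using y(1) z(1) by simp
  qed
  moreover have "bounded D" unfolding D_def by (rule bounded_matrix_unit_cube)
  moreover have cube: "unit_cube \<in> lmeasurable" "measure lebesgue (unit_cube :: (real ^ 'n) set) = 1"
    using unit_cube_measure by auto
  have "D \<in> lmeasurable" "measure lebesgue D = \<bar>det A\<bar>"
    using measure_linear_image_abs_det[OF matrix_vector_mul_linear cube(1), of A] cube(2) by (auto simp: D_def)
  moreover have "lattice_vol L = \<bar>det A\<bar>" unfolding A(2) by (rule lattice_vol_eq[OF A(1)])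
  moreover have "det A \<noteq> 0" using A(1) by (simp add: invertible_det_nz)
  ultimately show ?thesis using that[of D] by simp
qed

lemma measure_tiling_sum:
  assumes Q: "Q \<in> lmeasurable" and P: "\<And>e. e \<in> T \<Longrightarrow> P e \<in> lmeasurable" and T: "finite T"
    and tile: "\<And>y. y \<in> Q \<Longrightarrow> \<exists>!e. e \<in> T \<and> y \<in> P e"
  shows "(\<Sum>e\<in>T. measure lebesgue (Q \<inter> P e)) = measure lebesgue Q"
proof -
  have "Q = (\<Union>e\<in>T. Q \<inter> P e)" using tile by blast
  moreover have "measure lebesgue (\<Union>e\<in>T. Q \<inter> P e) = (\<Sum>e\<in>T. measure lebesgue (Q \<inter> P e))"
  proof (rule measure_UNION'[OF T])
    show "Q \<inter> P e \<in> lmeasurable" if "e \<in> T" for e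
      using Q P[OF that] by (rule fmeasurable.Int)
    show "pairwise (\<lambda>i j. disjnt (Q \<inter> P i) (Q \<inter> P j)) T"
      using tile unfolding pairwise_def disjnt_def by blast
  qed
  ultimately show ?thesis by simp
qed

lemma lattice_coset_eq_iff:
  assumes "full_rank_lattice L"
  shows "(+) x ` L = (+) y ` L \<longleftrightarrow> y - x \<in> L"
proof
  have L: "0 \<in> L" "\<And>u v. u \<in> L \<Longrightarrow> v \<in> L \<Longrightarrow> u + v \<in> L" "\<And>u. u \<in> L \<Longrightarrow> - u \<in> L"
    using assms by (auto simp: full_rank_lattice_def)
  have sub: "(+) a ` L \<subseteq> (+) b ` L" if "a - b \<in> L" for a b
  proof
    fix z assume "z \<in> (+) a ` L"
    then obtain l where "l \<in> L" "z = b + ((a - b) + l)" by (auto simp: algebra_simps)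
    then show "z \<in> (+) b ` L" using L(2) that by blast
  qed
  show "y - x \<in> L" if "(+) x ` L = (+) y ` L"
  proof -
    have "y + 0 \<in> (+) x ` L" using that L(1) by blast
    then show ?thesis by auto
  qed
  show "(+) x ` L = (+) y ` L" if "y - x \<in> L"
    using sub[of x y] sub[of y x] that L(3)[OF that] by simp
qed

lemma mem_translation_iff: "y \<in> (+) x ` L \<longleftrightarrow> y - x \<in> L" for x y :: "'a :: ab_group_add"
  by (auto intro!: image_eqI[of y _ "y - x"])

text \<open> This turns the theorem into a matching problem: a fundamental domain is a set that the coset map
  takes bijectively onto the set of all cosets. \<close>
lemma fundamental_domain_iff_transversal:
  assumes L: "full_rank_lattice L"
  shows "fundamental_domain L F \<longleftrightarrow> bij_betw (\<lambda>x. (+) x ` L) F (range (\<lambda>x. (+) x ` L))"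
proof -
  have mem: "y \<in> (+) x ` L \<longleftrightarrow> (+) x ` L = (+) y ` L" for x y
    unfolding lattice_coset_eq_iff[OF L] by (rule mem_translation_iff)
  show ?thesis
    unfolding fundamental_domain_def mem Int_iff bij_betw_def inj_on_def
    by (auto simp: image_iff set_eq_iff[of "_ ` F"]) metis+
qed

section \<open>Common fundamental domains\<close>

theorem theorem1p2:
  fixes L M :: "(real ^ 'n) set"
  assumes "full_rank_lattice L" and "full_rank_lattice M"
    and "lattice_vol L = lattice_vol M"
  shows "\<exists>F. bounded F \<and> fundamental_domain L F \<and> fundamental_domain M F"
proof -
  obtain D where D: "fundamental_domain L D" "bounded D" "D \<in> lmeasurable"
    "measure lebesgue D = lattice_vol L" "0 < lattice_vol L"
    using lattice_measurable_domain[OF assms(1)] by blast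
  obtain D' where D': "fundamental_domain M D'" "bounded D'" "D' \<in> lmeasurable"
    "measure lebesgue D' = lattice_vol L"
    using lattice_measurable_domain[OF assms(2)] assms(3) by metis
  \<comment> \<open>Only points of \<open>E\<close> have nonzero weight, so every coset has its full weight inside \<open>E\<close>.\<close>
  define E where "E = (\<Union>a\<in>D. \<Union>b\<in>D'. {a - b})"
  define g where "g e = measure lebesgue (D' \<inter> (+) (- e) ` D)" for e
  have bE: "bounded E" unfolding E_def by (rule bounded_differences[OF D(2) D'(2)])
  have g_sym: "g e = measure lebesgue (D \<inter> (+) e ` D')" for e
  proof -
    have "(+) e ` (D' \<inter> (+) (- e) ` D) = D \<inter> (+) e ` D'"
      by (auto simp: image_iff algebra_simps)
    then show ?thesis unfolding g_def by (metis measure_translation)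
  qed
  have fin: "finite (E \<inter> (+) x ` K)" if K: "full_rank_lattice K" for K x
  proof -
    have "E \<inter> (+) x ` K = (+) x ` (K \<inter> (+) (- x) ` E)" by (auto simp: image_iff algebra_simps)
    then show ?thesis
      using lattice_finite_Int_bounded[OF K bounded_translation[OF bE, of "- x"]] by simp
  qed
  have sumL: "sum g (E \<inter> (+) x ` L) = lattice_vol L" for x
    unfolding g_def D'(4)[symmetric]
  proof (rule measure_tiling_sum[OF D'(3) measurable_translation[OF D(3)] fin[OF assms(1)]])
    fix y assume y: "y \<in> D'"
    \<comment> \<open>The tiles \<open>D - e\<close> containing \<open>y\<close> correspond to the points \<open>y + e\<close> of \<open>D\<close> in the coset of \<open>y + x\<close>.\<close>
    have "\<exists>!z. z \<in> D \<inter> (+) (y + x) ` L" using D(1) by (simp add: fundamental_domain_def)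
    then obtain z where z: "z \<in> D \<inter> (+) (y + x) ` L" "\<And>w. w \<in> D \<inter> (+) (y + x) ` L \<Longrightarrow> w = z"
      by blast
    have iff: "e \<in> E \<inter> (+) x ` L \<and> y \<in> (+) (- e) ` D \<longleftrightarrow> y + e \<in> D \<inter> (+) (y + x) ` L" for e
      using y by (force simp: E_def image_iff algebra_simps)
    show "\<exists>!e. e \<in> E \<inter> (+) x ` L \<and> y \<in> (+) (- e) ` D"
      unfolding iff
    proof (rule ex1I[of _ "z - y"])
      show "y + (z - y) \<in> D \<inter> (+) (y + x) ` L" using z(1) by simp
      show "e = z - y" if "y + e \<in> D \<inter> (+) (y + x) ` L" for e
        using z(2)[OF that] by (simp add: eq_diff_eq add.commute)
    qed
  qed
  have sumM: "sum g (E \<inter> (+) x ` M) = lattice_vol L" for x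
    unfolding g_sym D(4)[symmetric]
  proof (rule measure_tiling_sum[OF D(3) measurable_translation[OF D'(3)] fin[OF assms(2)]])
    fix y assume y: "y \<in> D"
    have neg: "- l \<in> M \<longleftrightarrow> l \<in> M" for l
      using assms(2) unfolding full_rank_lattice_def by (metis minus_minus)
    have "\<exists>!z. z \<in> D' \<inter> (+) (y - x) ` M" using D'(1) by (simp add: fundamental_domain_def)
    then obtain z where z: "z \<in> D' \<inter> (+) (y - x) ` M" "\<And>w. w \<in> D' \<inter> (+) (y - x) ` M \<Longrightarrow> w = z"
      by blast
    have iff: "e \<in> E \<inter> (+) x ` M \<and> y \<in> (+) e ` D' \<longleftrightarrow> y - e \<in> D' \<inter> (+) (y - x) ` M" for e
    proof -
      have "e \<in> (+) x ` M \<longleftrightarrow> y - e \<in> (+) (y - x) ` M"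
        using neg[of "e - x"] by (simp add: mem_translation_iff)
      then show ?thesis using y by (force simp: E_def image_iff algebra_simps)
    qed
    show "\<exists>!e. e \<in> E \<inter> (+) x ` M \<and> y \<in> (+) e ` D'"
      unfolding iff
    proof (rule ex1I[of _ "y - z"])
      show "y - (y - z) \<in> D' \<inter> (+) (y - x) ` M" using z(1) by simp
      show "e = y - z" if "y - e \<in> D' \<inter> (+) (y - x) ` M" for e
        using z(2)[OF that] by (simp add: eq_diff_eq diff_eq_eq add.commute)
    qed
  qed
  have fibre: "{d \<in> E. (+) d ` K = (+) e ` K} = E \<inter> (+) e ` K" if K: "full_rank_lattice K" for K e
  proof -
    have "(+) d ` K = (+) e ` K \<longleftrightarrow> d \<in> (+) e ` K" for d
      unfolding mem_translation_iff lattice_coset_eq_iff[OF K, symmetric] by (rule eq_commute)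
    then show ?thesis by auto
  qed
  have pos: "0 \<le> g e" for e by (simp add: g_def)
  have vertex: "finite {d \<in> E. (+) d ` K = (+) e ` K} \<and> sum g {d \<in> E. (+) d ` K = (+) e ` K} = lattice_vol L"
    if K: "full_rank_lattice K" and s: "\<And>x. sum g (E \<inter> (+) x ` K) = lattice_vol L" for K e
    unfolding fibre[OF K] using fin[OF K] s by blast
  obtain F where F: "F \<subseteq> E" "bij_betw (\<lambda>x. (+) x ` L) F ((\<lambda>x. (+) x ` L) ` E)"
    "bij_betw (\<lambda>x. (+) x ` M) F ((\<lambda>x. (+) x ` M) ` E)"
    using fractional_imp_perfect_matching[OF pos D(5) vertex[OF assms(1) sumL] vertex[OF assms(2) sumM]]
    by metis
  \<comment> \<open>A coset missing \<open>E\<close> would have weight zero, so the matching covers all cosets.\<close>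
  have all: "(\<lambda>x. (+) x ` K) ` E = range (\<lambda>x. (+) x ` K)"
    if K: "full_rank_lattice K" and s: "\<And>x. sum g (E \<inter> (+) x ` K) = lattice_vol L" for K
  proof -
    have "\<exists>e\<in>E. (+) x ` K = (+) e ` K" for x
    proof -
      have "E \<inter> (+) x ` K \<noteq> {}" using s[of x] D(5) by auto
      then show ?thesis using fibre[OF K] by blast
    qed
    then show ?thesis by (auto simp: image_iff)
  qed
  have "fundamental_domain L F" "fundamental_domain M F"
    using F all[OF assms(1) sumL] all[OF assms(2) sumM]
    by (simp_all add: fundamental_domain_iff_transversal assms)
  then show ?thesis using bounded_subset[OF bE F(1)] by blast
qed

end
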